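(* Let $(R,P)$ be a Rota-Baxter algebra of weight $\lambda$ over a unitary commutative ring $\mathbf{k}$, where $\lambda$ is torsion free in $R$. Let $f=(f_1,f_2):R\to R\oplus R$ be the pair of $\mathbf{k}$-linear maps corresponding to $P$ by the additive Atkinson factorization, that is, $f_1=P$ and $f_2=\tilde P:=-\lambda\,\mathrm{id}_R-P$. Then an $(R,P)$-module $(M,p)$ is equivalent to a pair of $\mathbf{k}$-linear maps $\rho=(\rho_1,\rho_2):M\to M\oplus M$ (on an $R$-module $M$) such that $\rho_1(x)+\rho_2(x)=-\lambda x$ for all $x\in M$ and $f(R)\ast\rho(M)\subseteq\rho(M)$, where $$\ast:(R\oplus R)\otimes(M\oplus M)\to M\oplus M,\qquad (r_1,r_2)\ast(x_1,x_2):=(r_1x_1,-r_2x_2)$$ for all $r_1,r_2\in R$, $x_1,x_2\in M$.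
   Context: Algebras are unitary associative over $\mathbf{k}$. A Rota-Baxter algebra of weight $\lambda\in\mathbf{k}$ is a pair $(R,P)$ with $R$ a $\mathbf{k}$-algebra and $P:R\to R$ $\mathbf{k}$-linear with $P(x)P(y)=P(xP(y))+P(P(x)y)+\lambda P(xy)$ for all $x,y\in R$. An $(R,P)$-module is a pair $(M,p)$ with $M$ a left $R$-module and $p:M\to M$ $\mathbf{k}$-linear such that $P(a)p(x)=p(ap(x))+p(P(a)x)+\lambda p(ax)$ for all $a\in R$, $x\in M$. "$\lambda$ is torsion free in $R$" means that $\lambda r=0$ with $r\in R$ implies $r=0$. The additive Atkinson factorization says that, when $\lambda$ is torsion free in $R$, Rota-Baxter operators $P$ of weight $\lambda$ on $R$ correspond one-to-one to $\mathbf{k}$-linear maps $f=(f_1,f_2):R\to R\oplus R$ with $f_1(r)+f_2(r)=-\lambda r$ for all $r\in R$ and $f(R)$ closed under the multiplication $(r_1,r_2)(s_1,s_2)=(r_1s_1,-r_2s_2)$, via $f_1=P$, $f_2=\tilde P$. In the module statement the correspondence is the analogous one, $\rho_1=p$ and $\rho_2=-\lambda\,\mathrm{id}_M-p$. Here $f(R)\ast\rho(M)\subseteq\rho(M)$ means $f(r)\ast\rho(x)\in\rho(M)$ for all $r\in R$, $x\in M$.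
   Formalization: That every pair ρ comes from an (R,P)-module is proved only when λ is also torsion free in M; without this it fails, e.g. k=R=Z, λ=2, P=0, M=Z/2, ρ=(id,id); the other direction and injectivity hold for all M. *)

theory Defs
  imports "HOL-Algebra.Module" "HOL-Library.FuncSet"
begin

(* The library locale "algebra" requires the algebra to be commutative, and "module" requires the
   ring of scalars to be commutative. The algebra R below is an arbitrary associative unital one;
   R and M are both records of library modules over k, and the multiplication fields of the record
   M play no role. *)
locale unital_algebra = module k R + ring R for k (structure) and R (structure) +
  assumes smult_mult_left:
      "\<lbrakk>c \<in> carrier k; x \<in> carrier R; y \<in> carrier R\<rbrakk>
        \<Longrightarrow> (c \<odot>\<^bsub>R\<^esub> x) \<otimes>\<^bsub>R\<^esub> y = c \<odot>\<^bsub>R\<^esub> (x \<otimes>\<^bsub>R\<^esub> y)"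
    and smult_mult_right:
      "\<lbrakk>c \<in> carrier k; x \<in> carrier R; y \<in> carrier R\<rbrakk>
        \<Longrightarrow> x \<otimes>\<^bsub>R\<^esub> (c \<odot>\<^bsub>R\<^esub> y) = c \<odot>\<^bsub>R\<^esub> (x \<otimes>\<^bsub>R\<^esub> y)"

(* The last axiom says that the k-module structure of M is the one it gets from the R-action:
   with act_one it gives c x = (c 1) x. *)
locale algebra_left_module =
  alg: unital_algebra k R + mdl: module k M
  for k :: "('k, 'e) ring_scheme" and R :: "('k, 'r, 'f) module_scheme"
    and M :: "('k, 'm, 'g) module_scheme" +
  fixes act :: "'r \<Rightarrow> 'm \<Rightarrow> 'm"
  assumes act_closed: "\<lbrakk>a \<in> carrier R; x \<in> carrier M\<rbrakk> \<Longrightarrow> act a x \<in> carrier M"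
    and act_add_left: "\<lbrakk>a \<in> carrier R; b \<in> carrier R; x \<in> carrier M\<rbrakk>
        \<Longrightarrow> act (a \<oplus>\<^bsub>R\<^esub> b) x = act a x \<oplus>\<^bsub>M\<^esub> act b x"
    and act_add_right: "\<lbrakk>a \<in> carrier R; x \<in> carrier M; y \<in> carrier M\<rbrakk>
        \<Longrightarrow> act a (x \<oplus>\<^bsub>M\<^esub> y) = act a x \<oplus>\<^bsub>M\<^esub> act a y"
    and act_mult: "\<lbrakk>a \<in> carrier R; b \<in> carrier R; x \<in> carrier M\<rbrakk>
        \<Longrightarrow> act (a \<otimes>\<^bsub>R\<^esub> b) x = act a (act b x)"
    and act_one: "x \<in> carrier M \<Longrightarrow> act \<one>\<^bsub>R\<^esub> x = x"
    and act_smult: "\<lbrakk>c \<in> carrier k; a \<in> carrier R; x \<in> carrier M\<rbrakk>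
        \<Longrightarrow> act (c \<odot>\<^bsub>R\<^esub> a) x = c \<odot>\<^bsub>M\<^esub> act a x"

definition linear_map ::
  "('k, 'e) ring_scheme \<Rightarrow> ('k, 'a, 'f) module_scheme \<Rightarrow> ('k, 'b, 'g) module_scheme
    \<Rightarrow> ('a \<Rightarrow> 'b) \<Rightarrow> bool"
  where "linear_map k A B g \<longleftrightarrow>
    g \<in> carrier A \<rightarrow> carrier B \<and>
    (\<forall>x\<in>carrier A. \<forall>y\<in>carrier A. g (x \<oplus>\<^bsub>A\<^esub> y) = g x \<oplus>\<^bsub>B\<^esub> g y) \<and>
    (\<forall>c\<in>carrier k. \<forall>x\<in>carrier A. g (c \<odot>\<^bsub>A\<^esub> x) = c \<odot>\<^bsub>B\<^esub> g x)"

(* lam torsion free in R does not make lam torsion free in M: take k = R = Z, lam = 2, P = 0 and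
   M = Z/2. There (id, - 2 id - id) = (id, id) satisfies both conditions on pairs, since every
   f(r) * rho(x) is 0, but p = id is not an operator for (R, P): P(a) p(x) = 0 while
   p(a p(x)) + p(P(a) x) + 2 p(a x) = a x. An operator p always yields a pair and is determined by
   it; that every pair comes from an operator needs lam torsion free in M as well. *)
definition torsion_free :: "('k, 'a, 'f) module_scheme \<Rightarrow> 'k \<Rightarrow> bool"
  where "torsion_free A lam \<longleftrightarrow> (\<forall>x\<in>carrier A. lam \<odot>\<^bsub>A\<^esub> x = \<zero>\<^bsub>A\<^esub> \<longrightarrow> x = \<zero>\<^bsub>A\<^esub>)"

locale rota_baxter_algebra = unital_algebra k R
  for k :: "('k, 'e) ring_scheme" and R :: "('k, 'r, 'f) module_scheme" +
  fixes lam :: 'k and P :: "'r \<Rightarrow> 'r"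
  assumes weight_closed: "lam \<in> carrier k"
    and operator_linear: "linear_map k R R P"
    and rota_baxter: "\<lbrakk>x \<in> carrier R; y \<in> carrier R\<rbrakk> \<Longrightarrow>
      P x \<otimes>\<^bsub>R\<^esub> P y = P (x \<otimes>\<^bsub>R\<^esub> P y) \<oplus>\<^bsub>R\<^esub> P (P x \<otimes>\<^bsub>R\<^esub> y) \<oplus>\<^bsub>R\<^esub> lam \<odot>\<^bsub>R\<^esub> P (x \<otimes>\<^bsub>R\<^esub> y)"

locale rota_baxter_module =
  rba: rota_baxter_algebra k R lam P + algebra_left_module k R M act
  for k :: "('k, 'e) ring_scheme" and R :: "('k, 'r, 'f) module_scheme"
    and lam :: 'k and P :: "'r \<Rightarrow> 'r"
    and M :: "('k, 'm, 'g) module_scheme" and act :: "'r \<Rightarrow> 'm \<Rightarrow> 'm" +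
  fixes p :: "'m \<Rightarrow> 'm"
  assumes module_operator_linear: "linear_map k M M p"
    and module_rota_baxter: "\<lbrakk>a \<in> carrier R; x \<in> carrier M\<rbrakk> \<Longrightarrow>
      act (P a) (p x) = p (act a (p x)) \<oplus>\<^bsub>M\<^esub> p (act (P a) x) \<oplus>\<^bsub>M\<^esub> lam \<odot>\<^bsub>M\<^esub> p (act a x)"

(* The pair (q, - lam id - q) attached to an operator q on A, for A = R as well as for A = M. *)
definition atkinson_pair ::
  "('k, 'e) ring_scheme \<Rightarrow> ('k, 'a, 'f) module_scheme \<Rightarrow> 'k \<Rightarrow> ('a \<Rightarrow> 'a) \<Rightarrow> 'a \<Rightarrow> 'a \<times> 'a"
  where "atkinson_pair k A lam q =
    (\<lambda>x\<in>carrier A. (q x, (\<ominus>\<^bsub>k\<^esub> lam) \<odot>\<^bsub>A\<^esub> x \<ominus>\<^bsub>A\<^esub> q x))"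

definition twisted_act ::
  "('k, 'm, 'g) module_scheme \<Rightarrow> ('r \<Rightarrow> 'm \<Rightarrow> 'm) \<Rightarrow> 'r \<times> 'r \<Rightarrow> 'm \<times> 'm \<Rightarrow> 'm \<times> 'm"
  where "twisted_act M act r x = (act (fst r) (fst x), \<ominus>\<^bsub>M\<^esub> act (snd r) (snd x))"

definition atkinson_module_pair ::
  "('k, 'e) ring_scheme \<Rightarrow> ('k, 'r, 'f) module_scheme \<Rightarrow> 'k \<Rightarrow> ('r \<Rightarrow> 'r \<times> 'r)
    \<Rightarrow> ('k, 'm, 'g) module_scheme \<Rightarrow> ('r \<Rightarrow> 'm \<Rightarrow> 'm) \<Rightarrow> ('m \<Rightarrow> 'm \<times> 'm) \<Rightarrow> bool"
  where "atkinson_module_pair k R lam f M act \<rho> \<longleftrightarrow>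
    linear_map k M M (fst \<circ> \<rho>) \<and> linear_map k M M (snd \<circ> \<rho>) \<and>
    (\<forall>x\<in>carrier M. fst (\<rho> x) \<oplus>\<^bsub>M\<^esub> snd (\<rho> x) = (\<ominus>\<^bsub>k\<^esub> lam) \<odot>\<^bsub>M\<^esub> x) \<and>
    (\<forall>r\<in>carrier R. \<forall>x\<in>carrier M. twisted_act M act (f r) (\<rho> x) \<in> \<rho> ` carrier M)"

(* A correspondence between structures on M is one between maps defined on carrier M only. *)
definition rota_baxter_module_operators ::
  "('k, 'e) ring_scheme \<Rightarrow> ('k, 'r, 'f) module_scheme \<Rightarrow> 'k \<Rightarrow> ('r \<Rightarrow> 'r)
    \<Rightarrow> ('k, 'm, 'g) module_scheme \<Rightarrow> ('r \<Rightarrow> 'm \<Rightarrow> 'm) \<Rightarrow> ('m \<Rightarrow> 'm) set"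
  where "rota_baxter_module_operators k R lam P M act =
    {p \<in> extensional (carrier M). rota_baxter_module k R lam P M act p}"

definition atkinson_module_pairs ::
  "('k, 'e) ring_scheme \<Rightarrow> ('k, 'r, 'f) module_scheme \<Rightarrow> 'k \<Rightarrow> ('r \<Rightarrow> 'r \<times> 'r)
    \<Rightarrow> ('k, 'm, 'g) module_scheme \<Rightarrow> ('r \<Rightarrow> 'm \<Rightarrow> 'm) \<Rightarrow> ('m \<Rightarrow> 'm \<times> 'm) set"
  where "atkinson_module_pairs k R lam f M act =
    {\<rho> \<in> extensional (carrier M). atkinson_module_pair k R lam f M act \<rho>}"

end

theory Submission
  imports Defs
begin

text \<open>Write \<open>y = a p(x) + P(a) x + \<lambda> a x\<close>. Expanding the product of the second components
  gives \<open>f(a) * \<rho>(x) = (P(a) p(x), - \<lambda> y - P(a) p(x))\<close>. The module axiom says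
  \<open>p(y) = P(a) p(x)\<close>, so it implies \<open>f(a) * \<rho>(x) = \<rho>(y)\<close>. Conversely, if
  \<open>f(a) * \<rho>(x) = \<rho>(z)\<close>, then adding the two components gives \<open>\<lambda> z = \<lambda> y\<close>, and absence of
  \<open>\<lambda>\<close>-torsion in \<open>M\<close> yields \<open>z = y\<close>, hence the axiom.\<close>

context module
begin

lemma smult_r_diff:
  assumes "c \<in> carrier R" "x \<in> carrier M" "y \<in> carrier M"
  shows "c \<odot>\<^bsub>M\<^esub> (x \<ominus>\<^bsub>M\<^esub> y) = c \<odot>\<^bsub>M\<^esub> x \<ominus>\<^bsub>M\<^esub> c \<odot>\<^bsub>M\<^esub> y"
  using assms by (simp add: M.minus_eq smult_r_distr smult_r_minus)

lemma torsion_free_cancel: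
  assumes "torsion_free M c" "c \<in> carrier R" "x \<in> carrier M" "y \<in> carrier M"
    and "c \<odot>\<^bsub>M\<^esub> x = c \<odot>\<^bsub>M\<^esub> y"
  shows "x = y"
proof -
  have "c \<odot>\<^bsub>M\<^esub> (x \<ominus>\<^bsub>M\<^esub> y) = \<zero>\<^bsub>M\<^esub>"
    using assms by (simp add: smult_r_diff) (simp add: M.minus_eq M.r_neg)
  then have "x \<ominus>\<^bsub>M\<^esub> y = \<zero>\<^bsub>M\<^esub>"
    using assms by (simp add: torsion_free_def)
  \<comment> \<open>Uniqueness of inverses: \<open>x\<close> is inverse to the negative of
    \<open>y\<close>, hence equals \<open>y\<close>.\<close>
  then show ?thesis
    using assms M.minus_equality [of x "\<ominus>\<^bsub>M\<^esub> y"] by (simp add: M.minus_eq)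
qed

text \<open>In this context \<open>R\<close> is the ring of scalars; its commutativity makes
  multiplication by \<open>c\<close> linear. With \<open>c\<close> the negative of the weight, this
  is linearity of the second component of \<open>atkinson_pair\<close>.\<close>

lemma linear_map_smult_diff:
  assumes q: "linear_map R M M q" and c: "c \<in> carrier R"
  shows "linear_map R M M (\<lambda>x. c \<odot>\<^bsub>M\<^esub> x \<ominus>\<^bsub>M\<^esub> q x)"
proof -
  have closed: "q x \<in> carrier M" if "x \<in> carrier M" for x
    using q that by (auto simp: linear_map_def)
  have add: "c \<odot>\<^bsub>M\<^esub> (x \<oplus>\<^bsub>M\<^esub> y) \<ominus>\<^bsub>M\<^esub> q (x \<oplus>\<^bsub>M\<^esub> y)
      = (c \<odot>\<^bsub>M\<^esub> x \<ominus>\<^bsub>M\<^esub> q x) \<oplus>\<^bsub>M\<^esub> (c \<odot>\<^bsub>M\<^esub> y \<ominus>\<^bsub>M\<^esub> q y)"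
    if "x \<in> carrier M" "y \<in> carrier M" for x y
    using q that c closed
    by (simp add: linear_map_def smult_r_distr M.minus_eq M.minus_add M.a_ac)
  have smult: "c \<odot>\<^bsub>M\<^esub> (d \<odot>\<^bsub>M\<^esub> x) \<ominus>\<^bsub>M\<^esub> q (d \<odot>\<^bsub>M\<^esub> x)
      = d \<odot>\<^bsub>M\<^esub> (c \<odot>\<^bsub>M\<^esub> x \<ominus>\<^bsub>M\<^esub> q x)"
    if "d \<in> carrier R" "x \<in> carrier M" for d x
    using q that c closed
    by (simp add: linear_map_def smult_r_diff smult_assoc1 [symmetric] R.m_comm)
  show ?thesis
    using c closed add smult by (simp add: linear_map_def)
qed

end

text \<open>Linearity tests a map only on \<open>carrier A\<close>, which is closed under the module
  operations. This passes between the components of \<open>atkinson_pair\<close>, which is cut off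
  outside the carrier, and the formulas defining them.\<close>

lemma linear_map_cong:
  assumes "\<And>x. x \<in> carrier A \<Longrightarrow> g x = h x" "module k A"
  shows "linear_map k A B g \<longleftrightarrow> linear_map k A B h"
proof -
  interpret module k A by fact
  show ?thesis
    using assms(1) by (simp add: linear_map_def Pi_iff)
qed

context algebra_left_module
begin

text \<open>Scalars act on M through the multiples c 1 of the unit of R, and a (c 1) = c a.\<close>

lemma act_smult_right:
  assumes "c \<in> carrier k" "a \<in> carrier R" "x \<in> carrier M"
  shows "act a (c \<odot>\<^bsub>M\<^esub> x) = c \<odot>\<^bsub>M\<^esub> act a x"
proof -
  have "act a (c \<odot>\<^bsub>M\<^esub> x) = act a (act (c \<odot>\<^bsub>R\<^esub> \<one>\<^bsub>R\<^esub>) x)"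
    using assms by (simp add: act_smult act_one)
  also have "\<dots> = act (a \<otimes>\<^bsub>R\<^esub> (c \<odot>\<^bsub>R\<^esub> \<one>\<^bsub>R\<^esub>)) x"
    using assms by (simp add: act_mult)
  also have "\<dots> = c \<odot>\<^bsub>M\<^esub> act a x"
    using assms by (simp add: alg.smult_mult_right act_smult)
  finally show ?thesis .
qed

lemma act_zero_left: "x \<in> carrier M \<Longrightarrow> act \<zero>\<^bsub>R\<^esub> x = \<zero>\<^bsub>M\<^esub>"
  using act_smult [of "\<zero>\<^bsub>k\<^esub>" "\<zero>\<^bsub>R\<^esub>" x] by (simp add: act_closed)

lemma act_zero_right: "a \<in> carrier R \<Longrightarrow> act a \<zero>\<^bsub>M\<^esub> = \<zero>\<^bsub>M\<^esub>"
  using act_smult_right [of "\<zero>\<^bsub>k\<^esub>" a "\<zero>\<^bsub>M\<^esub>"] by (simp add: act_closed)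

lemma act_minus_left:
  assumes "a \<in> carrier R" "x \<in> carrier M"
  shows "act (\<ominus>\<^bsub>R\<^esub> a) x = \<ominus>\<^bsub>M\<^esub> act a x"
proof (rule mdl.M.minus_equality [symmetric])
  show "act (\<ominus>\<^bsub>R\<^esub> a) x \<oplus>\<^bsub>M\<^esub> act a x = \<zero>\<^bsub>M\<^esub>"
    using assms by (simp add: act_add_left [symmetric] alg.M.l_neg act_zero_left)
qed (use assms in \<open>simp_all add: act_closed\<close>)

lemma act_minus_right:
  assumes "a \<in> carrier R" "x \<in> carrier M"
  shows "act a (\<ominus>\<^bsub>M\<^esub> x) = \<ominus>\<^bsub>M\<^esub> act a x"
proof (rule mdl.M.minus_equality [symmetric])
  show "act a (\<ominus>\<^bsub>M\<^esub> x) \<oplus>\<^bsub>M\<^esub> act a x = \<zero>\<^bsub>M\<^esub>"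
    using assms by (simp add: act_add_right [symmetric] mdl.M.l_neg act_zero_right)
qed (use assms in \<open>simp_all add: act_closed\<close>)

text \<open>Of the four terms of the expanded product, all but b u contain the weight, so -lam can
  be pulled out of the other three. Putting b = P(a) and u = p(x) gives the second component of f(a)
  * \<rho>(x).\<close>

lemma minus_act_complement:
  assumes "lam \<in> carrier k" "a \<in> carrier R" "b \<in> carrier R" "x \<in> carrier M" "u \<in> carrier M"
  shows "\<ominus>\<^bsub>M\<^esub> act ((\<ominus>\<^bsub>k\<^esub> lam) \<odot>\<^bsub>R\<^esub> a \<ominus>\<^bsub>R\<^esub> b) ((\<ominus>\<^bsub>k\<^esub> lam) \<odot>\<^bsub>M\<^esub> x \<ominus>\<^bsub>M\<^esub> u)
    = (\<ominus>\<^bsub>k\<^esub> lam) \<odot>\<^bsub>M\<^esub> (act a u \<oplus>\<^bsub>M\<^esub> act b x \<oplus>\<^bsub>M\<^esub> lam \<odot>\<^bsub>M\<^esub> act a x) \<ominus>\<^bsub>M\<^esub> act b u"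
  using assms
  by (simp add: alg.M.minus_eq mdl.M.minus_eq act_add_left act_add_right act_minus_left
      act_minus_right act_smult act_smult_right act_closed mdl.smult_l_minus alg.smult_l_minus
      mdl.smult_r_distr mdl.smult_r_minus mdl.M.minus_add mdl.M.a_ac)

end

text \<open>The first component recovers the operator on the carrier, and extensionality fixes it
  elsewhere.\<close>

lemma inj_on_atkinson_pair: "inj_on (atkinson_pair k A lam) (extensional (carrier A))"
proof (rule inj_onI)
  fix p q
  assume p: "p \<in> extensional (carrier A)" and q: "q \<in> extensional (carrier A)"
    and eq: "atkinson_pair k A lam p = atkinson_pair k A lam q"
  have "p x = q x" if "x \<in> carrier A" for x
    using fun_cong [OF eq, of x] that by (simp add: atkinson_pair_def)
  then show "p = q"
    using p q by (metis extensionalityI)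
qed

text \<open>Everything except the operator on M is fixed here, so that \<open>p\<close> and \<rho>
  can range over all candidates.\<close>

locale rota_baxter_setting =
  rba: rota_baxter_algebra k R lam P + algebra_left_module k R M act
  for k :: "('k, 'e) ring_scheme" and R :: "('k, 'r, 'f) module_scheme"
    and lam :: 'k and P :: "'r \<Rightarrow> 'r"
    and M :: "('k, 'm, 'g) module_scheme" and act :: "'r \<Rightarrow> 'm \<Rightarrow> 'm"
begin

lemma operator_closed: "a \<in> carrier R \<Longrightarrow> P a \<in> carrier R"
  using rba.operator_linear by (auto simp: linear_map_def)

text \<open>The element called \<open>y\<close> in the introduction.\<close>

definition rb_arg :: "('m \<Rightarrow> 'm) \<Rightarrow> 'r \<Rightarrow> 'm \<Rightarrow> 'm"
  where "rb_arg p a x = act a (p x) \<oplus>\<^bsub>M\<^esub> act (P a) x \<oplus>\<^bsub>M\<^esub> lam \<odot>\<^bsub>M\<^esub> act a x"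

lemma rb_arg_closed:
  assumes "linear_map k M M p" "a \<in> carrier R" "x \<in> carrier M"
  shows "rb_arg p a x \<in> carrier M"
proof -
  have "p x \<in> carrier M"
    using assms by (auto simp: linear_map_def)
  then show ?thesis
    using assms rba.weight_closed by (simp add: rb_arg_def act_closed operator_closed)
qed

text \<open>By linearity the three terms on the right of the module axiom merge into a single value
  of \<open>p\<close>.\<close>

lemma linear_map_rb_arg:
  assumes "linear_map k M M p" "a \<in> carrier R" "x \<in> carrier M"
  shows "p (rb_arg p a x) = p (act a (p x)) \<oplus>\<^bsub>M\<^esub> p (act (P a) x) \<oplus>\<^bsub>M\<^esub> lam \<odot>\<^bsub>M\<^esub> p (act a x)"
proof -
  have "p x \<in> carrier M"
    using assms by (auto simp: linear_map_def)
  then show ?thesis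
    using assms rba.weight_closed
    by (simp add: rb_arg_def linear_map_def act_closed operator_closed)
qed

lemma twisted_act_atkinson_pair:
  assumes "linear_map k M M p" "a \<in> carrier R" "x \<in> carrier M"
  shows "twisted_act M act (atkinson_pair k R lam P a) (atkinson_pair k M lam p x)
    = (act (P a) (p x), (\<ominus>\<^bsub>k\<^esub> lam) \<odot>\<^bsub>M\<^esub> rb_arg p a x \<ominus>\<^bsub>M\<^esub> act (P a) (p x))"
proof -
  have "p x \<in> carrier M"
    using assms by (auto simp: linear_map_def)
  then show ?thesis
    using assms rba.weight_closed operator_closed
    by (simp add: twisted_act_def atkinson_pair_def minus_act_complement rb_arg_def)
qed

text \<open>The setting supplies the algebra and module parts of the predicate, and
  \<open>linear_map_rb_arg\<close> condenses the module axiom. In this form it says that P(a) p(x)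
  is the value of \<open>p\<close> at one explicit element.\<close>

lemma rota_baxter_module_iff:
  "rota_baxter_module k R lam P M act p \<longleftrightarrow>
    linear_map k M M p \<and>
    (\<forall>a\<in>carrier R. \<forall>x\<in>carrier M. act (P a) (p x) = p (rb_arg p a x))"
proof -
  have "rota_baxter_module k R lam P M act p \<longleftrightarrow> rota_baxter_module_axioms k R lam P M act p"
    using rba.rota_baxter_algebra_axioms algebra_left_module_axioms
    by (simp add: rota_baxter_module_def)
  then show ?thesis
    by (auto simp: rota_baxter_module_axioms_def linear_map_rb_arg)
qed

lemma atkinson_module_pair_if_rota_baxter_module:
  assumes "rota_baxter_module k R lam P M act p"
  shows "atkinson_module_pair k R lam (atkinson_pair k R lam P) M act (atkinson_pair k M lam p)"
proof -
  have p: "linear_map k M M p"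
    and rb: "\<And>a x. \<lbrakk>a \<in> carrier R; x \<in> carrier M\<rbrakk> \<Longrightarrow> act (P a) (p x) = p (rb_arg p a x)"
    using assms by (auto simp: rota_baxter_module_iff)
  have closed: "p x \<in> carrier M" if "x \<in> carrier M" for x
    using p that by (auto simp: linear_map_def)
  let ?q = "\<lambda>x. (\<ominus>\<^bsub>k\<^esub> lam) \<odot>\<^bsub>M\<^esub> x \<ominus>\<^bsub>M\<^esub> p x"
  have "linear_map k M M (fst \<circ> atkinson_pair k M lam p)"
    using p linear_map_cong [of M "fst \<circ> atkinson_pair k M lam p" p k M] mdl.module_axioms
    by (simp add: atkinson_pair_def)
  moreover have "linear_map k M M (snd \<circ> atkinson_pair k M lam p)"
    using mdl.linear_map_smult_diff [OF p, of "\<ominus>\<^bsub>k\<^esub> lam"] rba.weight_closed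
      linear_map_cong [of M "snd \<circ> atkinson_pair k M lam p" ?q k M] mdl.module_axioms
    by (simp add: atkinson_pair_def)
  moreover have "p x \<oplus>\<^bsub>M\<^esub> ((\<ominus>\<^bsub>k\<^esub> lam) \<odot>\<^bsub>M\<^esub> x \<ominus>\<^bsub>M\<^esub> p x) = (\<ominus>\<^bsub>k\<^esub> lam) \<odot>\<^bsub>M\<^esub> x"
    if "x \<in> carrier M" for x
    using that closed rba.weight_closed
    by (simp add: mdl.M.minus_eq mdl.M.r_neg
        mdl.M.a_lcomm [of "p x" "(\<ominus>\<^bsub>k\<^esub> lam) \<odot>\<^bsub>M\<^esub> x" "\<ominus>\<^bsub>M\<^esub> p x"])
  \<comment> \<open>\<open>rb_arg p a x\<close> is the witness for membership in the image: by
    \<open>rb\<close>, both occurrences of P(a) p(x) become the value of \<open>p\<close>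
    there.\<close>
  moreover have "twisted_act M act (atkinson_pair k R lam P a) (atkinson_pair k M lam p x)
      = atkinson_pair k M lam p (rb_arg p a x)"
    if "a \<in> carrier R" "x \<in> carrier M" for a x
    using twisted_act_atkinson_pair [OF p that] rb [OF that] rb_arg_closed [OF p that]
    by (simp add: atkinson_pair_def)
  ultimately show ?thesis
    using rb_arg_closed [OF p] by (simp add: atkinson_module_pair_def atkinson_pair_def)
qed

text \<open>The sum condition determines the second component from the first. Restricting the first
  component makes it extensional, so that it can serve as the preimage of \<rho> in the
  correspondence.\<close>

lemma atkinson_module_pair_eq_atkinson_pair:
  assumes \<rho>: "atkinson_module_pair k R lam f M act \<rho>" and ext: "\<rho> \<in> extensional (carrier M)"
  shows "\<rho> = atkinson_pair k M lam (restrict (fst \<circ> \<rho>) (carrier M))"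
proof (rule extensionalityI [OF ext])
  fix x
  assume x: "x \<in> carrier M"
  have "fst (\<rho> x) \<in> carrier M" "snd (\<rho> x) \<in> carrier M"
    and "(\<ominus>\<^bsub>k\<^esub> lam) \<odot>\<^bsub>M\<^esub> x = fst (\<rho> x) \<oplus>\<^bsub>M\<^esub> snd (\<rho> x)"
    using \<rho> x by (auto simp: atkinson_module_pair_def linear_map_def)
  then have "snd (\<rho> x) = (\<ominus>\<^bsub>k\<^esub> lam) \<odot>\<^bsub>M\<^esub> x \<ominus>\<^bsub>M\<^esub> fst (\<rho> x)"
    by (simp add: mdl.M.minus_eq mdl.M.a_assoc mdl.M.r_neg
        mdl.M.a_lcomm [of "fst (\<rho> x)" "snd (\<rho> x)" "\<ominus>\<^bsub>M\<^esub> fst (\<rho> x)"])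
  then show "\<rho> x = atkinson_pair k M lam (restrict (fst \<circ> \<rho>) (carrier M)) x"
    using x by (simp add: atkinson_pair_def prod_eq_iff)
qed (simp add: atkinson_pair_def)

lemma rota_baxter_module_if_atkinson_module_pair:
  assumes tf: "torsion_free M lam"
    and pair: "atkinson_module_pair k R lam (atkinson_pair k R lam P) M act
      (atkinson_pair k M lam p)"
  shows "rota_baxter_module k R lam P M act p"
proof -
  have p: "linear_map k M M p"
    using pair linear_map_cong [of M "fst \<circ> atkinson_pair k M lam p" p k M] mdl.module_axioms
    by (simp add: atkinson_module_pair_def) (simp add: atkinson_pair_def)
  have "act (P a) (p x) = p (rb_arg p a x)" if a: "a \<in> carrier R" and x: "x \<in> carrier M" for a x
  proof -
    let ?c = "\<ominus>\<^bsub>k\<^esub> lam"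
    have y: "rb_arg p a x \<in> carrier M"
      using p a x by (rule rb_arg_closed)
    have "twisted_act M act (atkinson_pair k R lam P a) (atkinson_pair k M lam p x)
        \<in> atkinson_pair k M lam p ` carrier M"
      using pair a x by (simp add: atkinson_module_pair_def)
    then obtain z where z: "z \<in> carrier M"
      and "twisted_act M act (atkinson_pair k R lam P a) (atkinson_pair k M lam p x)
        = atkinson_pair k M lam p z"
      by blast
    \<comment> \<open>Equality of the first components turns P(a) p(x) into \<open>p z\<close> in
      the second ones too, so the same term is subtracted on both sides and cancels.\<close>
    then have fst: "act (P a) (p x) = p z"
      and snd: "?c \<odot>\<^bsub>M\<^esub> rb_arg p a x \<ominus>\<^bsub>M\<^esub> p z = ?c \<odot>\<^bsub>M\<^esub> z \<ominus>\<^bsub>M\<^esub> p z"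
      unfolding twisted_act_atkinson_pair [OF p a x] by (auto simp: atkinson_pair_def)
    have "p z \<in> carrier M"
      using p z by (auto simp: linear_map_def)
    then have "?c \<odot>\<^bsub>M\<^esub> rb_arg p a x = ?c \<odot>\<^bsub>M\<^esub> z"
      using snd y z rba.weight_closed by (simp add: mdl.M.minus_eq)
    \<comment> \<open>Torsion freeness is stated for \<open>lam\<close> and not for its negative, so
      the sign is removed first.\<close>
    then have "lam \<odot>\<^bsub>M\<^esub> rb_arg p a x = lam \<odot>\<^bsub>M\<^esub> z"
      using y z rba.weight_closed
      by (metis mdl.M.minus_minus mdl.smult_closed mdl.smult_l_minus)
    then have "rb_arg p a x = z"
      using mdl.torsion_free_cancel tf y z rba.weight_closed by blast
    then show ?thesis
      using fst by simp
  qed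
  with p show ?thesis
    by (simp add: rota_baxter_module_iff)
qed

lemma atkinson_pair_image_subset:
  "atkinson_pair k M lam ` rota_baxter_module_operators k R lam P M act
    \<subseteq> atkinson_module_pairs k R lam (atkinson_pair k R lam P) M act"
  using atkinson_module_pair_if_rota_baxter_module
  by (auto simp: rota_baxter_module_operators_def atkinson_module_pairs_def)
    (simp add: atkinson_pair_def)

lemma atkinson_module_pairs_subset:
  assumes "torsion_free M lam"
  shows "atkinson_module_pairs k R lam (atkinson_pair k R lam P) M act
    \<subseteq> atkinson_pair k M lam ` rota_baxter_module_operators k R lam P M act"
proof
  fix \<rho>
  assume "\<rho> \<in> atkinson_module_pairs k R lam (atkinson_pair k R lam P) M act"
  then have \<rho>: "atkinson_module_pair k R lam (atkinson_pair k R lam P) M act \<rho>"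
    and ext: "\<rho> \<in> extensional (carrier M)"
    by (auto simp: atkinson_module_pairs_def)
  let ?p = "restrict (fst \<circ> \<rho>) (carrier M)"
  have eq: "\<rho> = atkinson_pair k M lam ?p"
    using \<rho> ext by (rule atkinson_module_pair_eq_atkinson_pair)
  then have "rota_baxter_module k R lam P M act ?p"
    using rota_baxter_module_if_atkinson_module_pair [OF assms, of ?p] \<rho> by metis
  then show "\<rho> \<in> atkinson_pair k M lam ` rota_baxter_module_operators k R lam P M act"
    using eq by (auto simp: rota_baxter_module_operators_def)
qed

end

theorem theorem2p11:
  fixes k :: "('k, 'e) ring_scheme"
    and R :: "('k, 'r, 'f) module_scheme"
    and M :: "('k, 'm, 'g) module_scheme"
    and lam :: 'k and P :: "'r \<Rightarrow> 'r" and act :: "'r \<Rightarrow> 'm \<Rightarrow> 'm"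
  assumes "rota_baxter_algebra k R lam P"
    and "torsion_free R lam"
    and "algebra_left_module k R M act"
  shows "atkinson_pair k M lam ` rota_baxter_module_operators k R lam P M act
           \<subseteq> atkinson_module_pairs k R lam (atkinson_pair k R lam P) M act \<and>
         inj_on (atkinson_pair k M lam) (rota_baxter_module_operators k R lam P M act) \<and>
         (torsion_free M lam \<longrightarrow>
           bij_betw (atkinson_pair k M lam)
             (rota_baxter_module_operators k R lam P M act)
             (atkinson_module_pairs k R lam (atkinson_pair k R lam P) M act))"
proof -
  interpret rota_baxter_setting k R lam P M act
    using assms by (simp add: rota_baxter_setting_def)
  have inj: "inj_on (atkinson_pair k M lam) (rota_baxter_module_operators k R lam P M act)"
    using inj_on_atkinson_pair
    by (rule inj_on_subset) (auto simp: rota_baxter_module_operators_def)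
  \<comment> \<open>If M has no \<open>lam\<close>-torsion, the two inclusions make the image all of
    the pairs; with \<open>inj\<close> this is the bijection.\<close>
  then show ?thesis
    using atkinson_pair_image_subset atkinson_module_pairs_subset
    by (auto simp: bij_betw_def)
qed

end
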